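(* (1) Let $\overline{\alpha}\in SP^+$. Then for every $n\in\mathbb{N}$ there are infinitely many convergent numerators $p_k$ of $\overline{\alpha}$ such that $n\mid p_k$. (2) Let $\overline{\alpha}\in ESP^+$ with $0<\alpha<1$. Then for every $n\in\mathbb{N}$ there are infinitely many convergent numerators $p_k$ of $\overline{\alpha}$ such that $n\mid p_k$.
   Context: $\overline{\alpha}=[a_0;a_1,a_2,\dots]$ denotes the continued fraction expansion of a real number $\alpha$ ($a_0\in\mathbb{Z}$, $a_i\in\mathbb{N}$ for $i\ge1$). Its convergents $\frac{p_k}{q_k}=[a_0;a_1,\dots,a_k]$ are given by $p_{-1}=1,\ p_0=a_0,\ p_k=a_kp_{k-1}+p_{k-2}$ and $q_{-1}=0,\ q_0=1,\ q_k=a_kq_{k-1}+q_{k-2}$; $p_k$ and $q_k$ are the $k$-th convergent numerator and denominator. A bar over a block of partial quotients denotes infinite repetition. A continued fraction is strictly periodic if it has the form $[\overline{a_0;a_1,\dots,a_{s-1}}]$ or $[0;\overline{a_1,\dots,a_s}]$. It is essentially periodic if it has the form $[a_0;\overline{a_1,\dots,a_s}]$ with $a_0\le a_s$, or $[0;a_1,\overline{a_2,\dots,a_{s+1}}]$ with $a_1\le a_{s+1}$. $SP^+$ and $ESP^+$ are the sets of strictly periodic, respectively essentially periodic, continued fractions representing positive numbers. *)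

theory Defs
  imports Complex_Main
begin

text \<open>
  An infinite simple continued fraction \<open>[a\<^sub>0; a\<^sub>1, a\<^sub>2, \<dots>]\<close> is its sequence of partial
  quotients; only \<open>a\<^sub>0\<close> may be nonpositive.
\<close>

definition continued_fraction :: "(nat \<Rightarrow> int) \<Rightarrow> bool" where
  "continued_fraction a \<longleftrightarrow> (\<forall>i\<ge>1. a i \<ge> 1)"

text \<open>
  In the next two definitions the second equation is the recurrence for \<open>k = 1\<close>, with the
  initial values \<open>p\<^bsub>-1\<^esub> = 1\<close> and \<open>q\<^bsub>-1\<^esub> = 0\<close> inserted, as indices here are natural numbers.
\<close>

fun conv_num :: "(nat \<Rightarrow> int) \<Rightarrow> nat \<Rightarrow> int" where
  "conv_num a 0 = a 0"
| "conv_num a (Suc 0) = a 1 * a 0 + 1"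
| "conv_num a (Suc (Suc k)) = a (Suc (Suc k)) * conv_num a (Suc k) + conv_num a k"

fun conv_denom :: "(nat \<Rightarrow> int) \<Rightarrow> nat \<Rightarrow> int" where
  "conv_denom a 0 = 1"
| "conv_denom a (Suc 0) = a 1 * 1 + 0"
| "conv_denom a (Suc (Suc k)) = a (Suc (Suc k)) * conv_denom a (Suc k) + conv_denom a k"

definition convergent_cf :: "(nat \<Rightarrow> int) \<Rightarrow> nat \<Rightarrow> real" where
  "convergent_cf a k = of_int (conv_num a k) / of_int (conv_denom a k)"

text \<open>
  The limit exists for every continued fraction, see \<open>convergent_cf_LIMSEQ\<close> below.
\<close>

definition cf_value :: "(nat \<Rightarrow> int) \<Rightarrow> real" where
  "cf_value a = lim (convergent_cf a)"

text \<open>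
  \<open>periodic_from m s a\<close>: the block \<open>a\<^sub>m, \<dots>, a\<^bsub>m+s-1\<^esub>\<close> is repeated forever from index \<open>m\<close> on;
  \<open>s\<close> need not be the least period.
\<close>

definition periodic_from :: "nat \<Rightarrow> nat \<Rightarrow> (nat \<Rightarrow> int) \<Rightarrow> bool" where
  "periodic_from m s a \<longleftrightarrow> s \<ge> 1 \<and> (\<forall>i\<ge>m. a (i + s) = a i)"

definition strictly_periodic :: "(nat \<Rightarrow> int) \<Rightarrow> bool" where
  "strictly_periodic a \<longleftrightarrow>
     (\<exists>s. periodic_from 0 s a) \<or>
     (\<exists>s. a 0 = 0 \<and> periodic_from 1 s a)"

definition essentially_periodic :: "(nat \<Rightarrow> int) \<Rightarrow> bool" where
  "essentially_periodic a \<longleftrightarrow>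
     (\<exists>s. periodic_from 1 s a \<and> a 0 \<le> a s) \<or>
     (\<exists>s. a 0 = 0 \<and> periodic_from 2 s a \<and> a 1 \<le> a (s + 1))"

definition SP_plus :: "(nat \<Rightarrow> int) set" where
  "SP_plus = {a. continued_fraction a \<and> strictly_periodic a \<and> cf_value a > 0}"

definition ESP_plus :: "(nat \<Rightarrow> int) set" where
  "ESP_plus = {a. continued_fraction a \<and> essentially_periodic a \<and> cf_value a > 0}"

lemma conv_denom_ge:
  assumes "continued_fraction a"
  shows "conv_denom a k \<ge> 1 \<and> conv_denom a (Suc k) \<ge> conv_denom a k \<and> conv_denom a (Suc k) \<ge> int (Suc k)"
proof (induction k)
  case 0
  then show ?case using assms by (simp add: continued_fraction_def)
next
  case (Suc k)
  have "a (Suc (Suc k)) \<ge> 1" using assms by (simp add: continued_fraction_def)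
  then have "1 * conv_denom a (Suc k) \<le> a (Suc (Suc k)) * conv_denom a (Suc k)"
    using Suc by (intro mult_right_mono) auto
  then show ?case using Suc unfolding conv_denom.simps by linarith
qed

lemma conv_det:
  "conv_num a (Suc k) * conv_denom a k - conv_num a k * conv_denom a (Suc k) = (-1) ^ k"
proof (induction k)
  case 0
  show ?case by simp
next
  case (Suc k)
  then show ?case by (simp add: algebra_simps)
qed

lemma convergent_cf_LIMSEQ:
  assumes "continued_fraction a"
  shows "convergent_cf a \<longlonglongrightarrow> cf_value a"
proof -
  define q where "q k = real_of_int (conv_denom a k)" for k
  define d where "d k = 1 / (q k * q (Suc k))" for k
  have q1: "q k \<ge> 1" and qm: "q (Suc k) \<ge> q k" and qn: "q (Suc k) \<ge> real (Suc k)" for k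
    using conv_denom_ge[OF assms, of k] unfolding q_def by linarith+
  have qp: "q k > 0" for k using q1[of k] by linarith
  have step: "convergent_cf a (Suc k) - convergent_cf a k = (-1) ^ k * d k" for k
  proof -
    have "real_of_int (conv_num a (Suc k)) * q k - real_of_int (conv_num a k) * q (Suc k) = (-1) ^ k"
      using arg_cong[OF conv_det[of a k], of real_of_int] by (simp add: q_def)
    then show ?thesis
      using qp[of k] qp[of "Suc k"]
      by (simp add: convergent_cf_def d_def diff_frac_eq flip: q_def)
  qed
  have mono: "monoseq d"
  proof (intro monoI2 allI impI)
    fix m n :: nat assume "m \<le> n"
    have "q m \<le> q n" "q (Suc m) \<le> q (Suc n)"
      using lift_Suc_mono_le[of q, OF qm] \<open>m \<le> n\<close> by auto
    then have "q m * q (Suc m) \<le> q n * q (Suc n)"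
      using qp less_imp_le by (intro mult_mono) blast+
    then show "d n \<le> d m"
      using qp by (simp add: d_def frac_le)
  qed
  have lim0: "d \<longlonglongrightarrow> 0"
  proof (rule tendsto_sandwich[of "\<lambda>_. 0" _ _ "\<lambda>k. inverse (real (Suc k))"])
    show "\<forall>\<^sub>F k in sequentially. 0 \<le> d k" using qp by (simp add: d_def less_imp_le)
    have "d k \<le> inverse (real (Suc k))" for k
    proof -
      have "1 * real (Suc k) \<le> q k * q (Suc k)"
        using q1 qn less_imp_le[OF qp] by (intro mult_mono) auto
      then show ?thesis by (simp add: d_def inverse_eq_divide frac_le)
    qed
    then show "\<forall>\<^sub>F k in sequentially. d k \<le> inverse (real (Suc k))"
      by (intro always_eventually allI)
  qed (use LIMSEQ_inverse_real_of_nat in auto)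
  have "summable (\<lambda>k. (-1) ^ k * d k)"
    by (rule summable_Leibniz(1)[OF lim0 mono])
  then have "convergent (\<lambda>n. \<Sum>k<n. convergent_cf a (Suc k) - convergent_cf a k)"
    by (simp add: step summable_iff_convergent)
  then have "convergent (\<lambda>n. convergent_cf a n - convergent_cf a 0)"
    by (simp only: sum_lessThan_telescope)
  then have "convergent (convergent_cf a)"
    by (simp add: convergent_diff_const_right_iff)
  then show ?thesis unfolding cf_value_def by (simp add: convergent_LIMSEQ_iff)
qed

end

theory Submission imports Defs "HOL-Number_Theory.Cong" begin

text \<open>
  A sequence \<open>x\<close> with \<open>x\<^sub>0 = 0\<close>, \<open>x\<^sub>1 = 1\<close> and \<open>x\<^bsub>k+2\<^esub> = c\<^sub>k x\<^bsub>k+1\<^esub> + x\<^sub>k\<close>, where \<open>c\<close> has period \<open>s\<close>,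
  can be run backwards modulo \<open>n\<close>. By the pigeonhole principle the pair
  \<open>(x\<^bsub>js\<^esub>, x\<^bsub>js+1\<^esub>)\<close> takes the same value modulo \<open>n\<close> for infinitely many \<open>j\<close>; if \<open>i\<close> and \<open>j \<ge> i\<close>
  are two of them, running back from \<open>is\<close> to \<open>0\<close> gives \<open>x\<^bsub>(j-i)s\<^esub> \<equiv> x\<^sub>0 = 0\<close>.
  The numerators form such a sequence in all cases: starting from \<open>p\<^bsub>-2\<^esub> = 0\<close>, \<open>p\<^bsub>-1\<^esub> = 1\<close> if
  the expansion is periodic from \<open>a\<^sub>0\<close> on, and from \<open>p\<^sub>0 = 0\<close>, \<open>p\<^sub>1 = 1\<close> if \<open>a\<^sub>0 = 0\<close>. In the
  latter case \<open>a\<^sub>1\<close> does not enter, so periodicity from \<open>a\<^sub>2\<close> on suffices.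
\<close>

lemma periodic_add_mult:
  fixes c :: "nat \<Rightarrow> 'a"
  assumes "\<And>k. c (k + s) = c k"
  shows "c (k + d * s) = c k"
proof (induction d)
  case (Suc d)
  then show ?case using assms[of "k + d * s"] by (simp add: algebra_simps)
qed simp

text \<open>\<open>x k\<close> enters the recurrence with coefficient 1, so it can be solved for
  without inverting \<open>c k\<close> modulo \<open>n\<close>; each induction step moves the
  congruent pair down by one index.\<close>

lemma recurrence_cong_backward:
  fixes x c :: "nat \<Rightarrow> int"
  assumes rec: "\<And>k. x (Suc (Suc k)) = c k * x (Suc k) + x k"
    and per: "\<And>k. c (k + D) = c k"
    and "[x (m + D) = x m] (mod n)" "[x (Suc m + D) = x (Suc m)] (mod n)"
  shows "[x D = x 0] (mod n)"
  using assms(3,4)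
proof (induction m)
  case (Suc m)
  have "x (m + D) = x (Suc (Suc m) + D) - c m * x (Suc m + D)"
    using rec[of "m + D"] per[of m] by simp
  moreover have "x m = x (Suc (Suc m)) - c m * x (Suc m)"
    using rec[of m] by simp
  ultimately have "[x (m + D) = x m] (mod n)"
    using Suc.prems by (auto intro!: cong_diff cong_mult)
  then show ?case using Suc.IH Suc.prems(1) by blast
qed simp

lemma recurrence_infinite_dvd_indices:
  fixes x c :: "nat \<Rightarrow> int"
  assumes rec: "\<And>k. x (Suc (Suc k)) = c k * x (Suc k) + x k"
    and per: "\<And>k. c (k + s) = c k" and "s \<ge> 1"
    and "x 0 = 0" and "n > 0"
  shows "infinite {k. n dvd x k}"
proof -
  define f where "f j = (x (j * s) mod n, x (Suc (j * s)) mod n)" for j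
  have "f ` UNIV \<subseteq> {0..<n} \<times> {0..<n}"
    using \<open>n > 0\<close> by (auto simp: f_def)
  then have "finite (f ` UNIV)"
    by (rule finite_subset) simp
  then obtain i where i: "infinite {j. f j = f i}"
    using pigeonhole_infinite[of UNIV f] by auto
  have "n dvd x ((j - i) * s)" if "f j = f i" "j \<ge> i" for j
  proof -
    have j: "j * s = i * s + (j - i) * s"
      using \<open>j \<ge> i\<close> by (simp flip: distrib_right)
    have "[x ((j - i) * s) = x 0] (mod n)"
    proof (rule recurrence_cong_backward[of x c, OF rec])
      show "c (k + (j - i) * s) = c k" for k
        by (rule periodic_add_mult[of c, OF per])
      show "[x (i * s + (j - i) * s) = x (i * s)] (mod n)"
        "[x (Suc (i * s) + (j - i) * s) = x (Suc (i * s))] (mod n)"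
        using \<open>f j = f i\<close> by (simp_all add: f_def cong_def j)
    qed
    then show ?thesis using \<open>x 0 = 0\<close> by (simp add: cong_0_iff)
  qed
  \<comment> \<open>The restriction to \<open>j \<ge> i\<close> keeps the truncated subtraction
    injective and discards only finitely many \<open>j\<close>.\<close>
  then have "(\<lambda>j. (j - i) * s) ` {j \<in> {j. f j = f i}. j \<ge> i} \<subseteq> {k. n dvd x k}"
    by auto
  moreover have "infinite {j \<in> {j. f j = f i}. j \<ge> i}"
  proof
    assume "finite {j \<in> {j. f j = f i}. j \<ge> i}"
    then have "finite ({j \<in> {j. f j = f i}. j \<ge> i} \<union> {..<i})" by simp
    then have "finite {j. f j = f i}" by (rule rev_finite_subset) auto
    then show False using i by blast
  qed
  moreover have "inj_on (\<lambda>j. (j - i) * s) {j \<in> {j. f j = f i}. j \<ge> i}"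
    using \<open>s \<ge> 1\<close> by (auto intro!: inj_onI)
  ultimately show ?thesis
    using finite_imageD finite_subset by blast
qed

text \<open>With \<open>c k \<ge> 1\<close> the sequence grows at least like a Fibonacci sequence.
  This bounds an index by its value, so infinitely many indices yield infinitely many distinct
  values.\<close>

lemma recurrence_ge:
  fixes x c :: "nat \<Rightarrow> int"
  assumes rec: "\<And>k. x (Suc (Suc k)) = c k * x (Suc k) + x k"
    and "\<And>k. c k \<ge> 1" and "x 0 = 0" "x 1 = 1"
  shows "x k \<ge> int k - 1 \<and> x k \<ge> 0 \<and> x (Suc k) \<ge> int k \<and> x (Suc k) \<ge> 1"
proof (induction k)
  case 0
  then show ?case using assms(3,4) by simp
next
  case (Suc k)
  have "1 * x (Suc k) \<le> c k * x (Suc k)"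
    using Suc assms(2)[of k] by (intro mult_right_mono) auto
  then have ge: "x (Suc (Suc k)) \<ge> x (Suc k) + x k" using rec[of k] by simp
  have "k = 0 \<or> x k \<ge> 1"
    using Suc assms(4) by (cases "k = 1") auto
  then show ?case using Suc ge by auto
qed

lemma recurrence_infinite_dvd_values:
  fixes x c :: "nat \<Rightarrow> int"
  assumes "\<And>k. x (Suc (Suc k)) = c k * x (Suc k) + x k"
    and "\<And>k. c (k + s) = c k" and "s \<ge> 1"
    and "\<And>k. c k \<ge> 1" and "x 0 = 0" "x 1 = 1" and "n > 0"
  shows "infinite {p. \<exists>k. p = x k \<and> n dvd p}"
proof
  assume "finite {p. \<exists>k. p = x k \<and> n dvd p}"
  then have "bdd_above {p. \<exists>k. p = x k \<and> n dvd p}"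
    by (rule bdd_above_finite)
  then obtain M where M: "\<And>k. n dvd x k \<Longrightarrow> x k \<le> M"
    by (auto simp: bdd_above_def)
  have "k \<le> nat (M + 1)" if "n dvd x k" for k
    using M[OF that] recurrence_ge[of x c k, OF assms(1,4,5,6)] by linarith
  then have "{k. n dvd x k} \<subseteq> {..nat (M + 1)}" by auto
  then have "finite {k. n dvd x k}" by (rule finite_subset) simp
  then show False
    using recurrence_infinite_dvd_indices[of x c s n, OF assms(1,2,3,5,7)] by blast
qed

lemma infinite_dvd_conv_num_periodic:
  assumes cf: "continued_fraction a" and per: "periodic_from 0 s a" and "n > 0"
  shows "infinite {p. \<exists>k. p = conv_num a k \<and> n dvd p}"
proof -
  define x where "x k = (if k = 0 then 0 else if k = 1 then 1 else conv_num a (k - 2))" for k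
  have "s \<ge> 1" and per': "a (k + s) = a k" for k
    using per by (auto simp: periodic_from_def)
  \<comment> \<open>For \<open>k = 0\<close> positivity comes from \<open>a 0 = a s\<close> with
    \<open>s \<ge> 1\<close>.\<close>
  have "a k \<ge> 1" for k
    using cf per'[of k] \<open>s \<ge> 1\<close> unfolding continued_fraction_def
    by (metis le_add2 le_trans)
  moreover have "x (Suc (Suc k)) = a k * x (Suc k) + x k" for k
    by (cases "(a, k)" rule: conv_num.cases) (auto simp: x_def)
  ultimately have "infinite {p. \<exists>k. p = x k \<and> n dvd p}"
    using per' \<open>s \<ge> 1\<close> \<open>n > 0\<close>
    by (intro recurrence_infinite_dvd_values[of x a s]) (auto simp: x_def)
  \<comment> \<open>The two prepended values need not be convergent numerators, but removing them
    leaves an infinite set.\<close>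
  moreover have "{p. \<exists>k. p = x k \<and> n dvd p}
      \<subseteq> {0, 1} \<union> {p. \<exists>k. p = conv_num a k \<and> n dvd p}"
    by (auto simp: x_def)
  ultimately have "infinite ({0, 1} \<union> {p. \<exists>k. p = conv_num a k \<and> n dvd p})"
    by (rule infinite_super[rotated])
  then show ?thesis by simp
qed

lemma infinite_dvd_conv_num_zero:
  assumes cf: "continued_fraction a" and "a 0 = 0"
    and per: "periodic_from m s a" and "m \<le> 2" and "n > 0"
  shows "infinite {p. \<exists>k. p = conv_num a k \<and> n dvd p}"
proof (rule recurrence_infinite_dvd_values[of "conv_num a" "\<lambda>k. a (k + 2)" s])
  show "a (k + s + 2) = a (k + 2)" for k
  proof -
    have "a (k + 2 + s) = a (k + 2)"
      using per \<open>m \<le> 2\<close> unfolding periodic_from_def by (meson trans_le_add2)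
    then show ?thesis by (simp add: algebra_simps)
  qed
qed (use assms in \<open>auto simp: periodic_from_def continued_fraction_def\<close>)

text \<open>Numerators and denominators obey the same recurrence with nonnegative coefficients, so
  both differences stay nonnegative once they are so at \<open>k = 0\<close> and
  \<open>k = 1\<close>.\<close>

lemma conv_num_bounds:
  assumes "continued_fraction a"
  shows "a 0 * conv_denom a k \<le> conv_num a k \<and> conv_num a k \<le> (a 0 + 1) * conv_denom a k"
proof (induction k rule: less_induct)
  case (less k)
  consider "k = 0" | "k = 1" | j where "k = Suc (Suc j)"
    by (metis One_nat_def not0_implies_Suc)
  then show ?case
  proof cases
    case 2
    then show ?thesis using assms by (auto simp: continued_fraction_def algebra_simps)
  next
    case (3 j)
    have a: "a k \<ge> 0" using assms[unfolded continued_fraction_def, rule_format, of k] 3 by simp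
    have "a k * (a 0 * conv_denom a (Suc j)) \<le> a k * conv_num a (Suc j)"
      "a k * conv_num a (Suc j) \<le> a k * ((a 0 + 1) * conv_denom a (Suc j))"
      using less.IH[of "Suc j"] a 3 by (auto intro!: mult_left_mono)
    then show ?thesis using less.IH[of j] 3 by (auto simp: algebra_simps)
  qed simp
qed

lemma cf_value_bounds:
  assumes "continued_fraction a"
  shows "of_int (a 0) \<le> cf_value a" "cf_value a \<le> of_int (a 0) + 1"
proof -
  have "of_int (a 0) \<le> convergent_cf a k \<and> convergent_cf a k \<le> of_int (a 0) + 1" for k
  proof -
    have "real_of_int (a 0 * conv_denom a k) \<le> of_int (conv_num a k)"
      "real_of_int (conv_num a k) \<le> of_int ((a 0 + 1) * conv_denom a k)"
      using conv_num_bounds[OF assms, of k] by (simp_all only: of_int_le_iff)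
    moreover have "real_of_int (conv_denom a k) > 0"
      using conv_denom_ge[OF assms, of k] by simp
    ultimately show ?thesis
      by (simp add: convergent_cf_def pos_le_divide_eq pos_divide_le_eq)
  qed
  then show "of_int (a 0) \<le> cf_value a" "cf_value a \<le> of_int (a 0) + 1"
    using convergent_cf_LIMSEQ[OF assms] by (blast intro: LIMSEQ_le_const LIMSEQ_le_const2)+
qed

theorem corollary3p7:
  "(\<forall>a \<in> SP_plus. \<forall>n::nat. n \<ge> 1 \<longrightarrow>
      infinite {p. \<exists>k. p = conv_num a k \<and> int n dvd p})
   \<and>
   (\<forall>a \<in> ESP_plus. 0 < cf_value a \<and> cf_value a < 1 \<longrightarrow>
      (\<forall>n::nat. n \<ge> 1 \<longrightarrow>
        infinite {p. \<exists>k. p = conv_num a k \<and> int n dvd p}))"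
proof (intro conjI ballI allI impI)
  fix a and n :: nat
  assume a: "a \<in> SP_plus" and "n \<ge> 1"
  have cf: "continued_fraction a" and n: "int n > 0"
    using a \<open>n \<ge> 1\<close> by (simp_all add: SP_plus_def)
  from a consider s where "periodic_from 0 s a" | s where "a 0 = 0" "periodic_from 1 s a"
    unfolding SP_plus_def strictly_periodic_def by blast
  then show "infinite {p. \<exists>k. p = conv_num a k \<and> int n dvd p}"
  proof cases
    case 1
    then show ?thesis by (rule infinite_dvd_conv_num_periodic[OF cf _ n])
  next
    case 2
    then show ?thesis by (rule infinite_dvd_conv_num_zero[OF cf _ _ _ n]) simp
  qed
next
  fix a and n :: nat
  assume a: "a \<in> ESP_plus" and v: "0 < cf_value a \<and> cf_value a < 1" and "n \<ge> 1"
  have cf: "continued_fraction a" and n: "int n > 0"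
    using a \<open>n \<ge> 1\<close> by (simp_all add: ESP_plus_def)
  \<comment> \<open>The strict bounds on the value leave 0 as the only integer with
    \<open>a 0 < 1\<close> and \<open>a 0 + 1 > 0\<close>.\<close>
  have a0: "a 0 = 0" using cf_value_bounds[OF cf] v by linarith
  from a obtain m s where "periodic_from m s a" "m \<le> 2"
    unfolding ESP_plus_def essentially_periodic_def by fastforce
  then show "infinite {p. \<exists>k. p = conv_num a k \<and> int n dvd p}"
    by (rule infinite_dvd_conv_num_zero[OF cf a0 _ _ n])
qed

end
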